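(* For every linear forest $H$ and every graph $G$, $G$ contains $H$ as an induced subgraph if and only if the blob graph $\mathrm{Blob}(G)$ contains $H$ as an induced subgraph.
   Context: A linear forest is a disjoint union of paths. Two vertex sets $X_1,X_2\subseteq V(G)$ are adjacent if $X_1\cap X_2\neq\emptyset$ or some edge of $G$ has one endpoint in $X_1$ and the other in $X_2$. The blob graph $\mathrm{Blob}(G)$ has as vertex set all sets $X\subseteq V(G)$ such that $G[X]$ is connected, with an edge between $X_1$ and $X_2$ whenever $X_1$ and $X_2$ are adjacent. *)

theory Defs
  imports "Graph_Theory.Digraph_Component" "Graph_Theory.Digraph_Isomorphism"
begin

text \<open>
  Finite simple undirected graphs are the locale \<^verbatim>\<open>pair_graph\<close>: finite, loop-free, and with a
  symmetric set of arcs, so that an edge \<^verbatim>\<open>uv\<close> is the pair of arcs \<^verbatim>\<open>(u,v)\<close>, \<^verbatim>\<open>(v,u)\<close>.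
\<close>

definition path_graph :: "'a list \<Rightarrow> 'a pair_pre_digraph" where
  "path_graph xs = \<lparr> pverts = set xs,
     parcs = {(xs ! i, xs ! Suc i) | i. Suc i < length xs}
           \<union> {(xs ! Suc i, xs ! i) | i. Suc i < length xs} \<rparr>"

definition is_path :: "'a pair_pre_digraph \<Rightarrow> bool" where
  "is_path P \<longleftrightarrow> (\<exists>xs. xs \<noteq> [] \<and> distinct xs \<and> P = path_graph xs)"

definition linear_forest :: "'a pair_pre_digraph \<Rightarrow> bool" where
  "linear_forest H \<longleftrightarrow> (\<exists>\<P>. finite \<P> \<and> (\<forall>P\<in>\<P>. is_path P) \<and>
     pairwise (\<lambda>P Q. disjnt (pverts P) (pverts Q)) \<P> \<and>
     H = \<lparr> pverts = (\<Union>P\<in>\<P>. pverts P), parcs = (\<Union>P\<in>\<P>. parcs P) \<rparr>)"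

definition adjacent_sets :: "'a pair_pre_digraph \<Rightarrow> 'a set \<Rightarrow> 'a set \<Rightarrow> bool" where
  "adjacent_sets G X\<^sub>1 X\<^sub>2 \<longleftrightarrow> X\<^sub>1 \<inter> X\<^sub>2 \<noteq> {} \<or> (\<exists>u\<in>X\<^sub>1. \<exists>v\<in>X\<^sub>2. (u, v) \<in> parcs G)"

text \<open>
  The library's \<^const>\<open>connected\<close> excludes the null graph, so the empty set is not a blob. Every blob
  is adjacent to itself in the sense of \<^const>\<open>adjacent_sets\<close>; the blob graph is simple, hence the
  condition \<^verbatim>\<open>X\<^sub>1 \<noteq> X\<^sub>2\<close>.
\<close>

definition Blob :: "'a pair_pre_digraph \<Rightarrow> 'a set pair_pre_digraph" where
  "Blob G = (let B = {X. X \<subseteq> pverts G \<and> connected (with_proj G \<restriction> X)} in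
     \<lparr> pverts = B,
       parcs = {(X\<^sub>1, X\<^sub>2). X\<^sub>1 \<in> B \<and> X\<^sub>2 \<in> B \<and> X\<^sub>1 \<noteq> X\<^sub>2 \<and> adjacent_sets G X\<^sub>1 X\<^sub>2} \<rparr>)"

definition contains_induced :: "'a pair_pre_digraph \<Rightarrow> 'b pair_pre_digraph \<Rightarrow> bool" where
  "contains_induced G H \<longleftrightarrow>
     (\<exists>K. induced_subgraph K (with_proj G) \<and> digraph_iso (with_proj H) K)"

lemma pair_graph_linear_forest:
  assumes "linear_forest H"
  shows "pair_graph H"
proof -
  have path: "pair_graph P" if P: "is_path P" for P :: "'a pair_pre_digraph"
  proof -
    from P obtain xs where xs: "distinct xs" "P = path_graph xs"
      by (auto simp: is_path_def)
    have "parcs P \<subseteq> pverts P \<times> pverts P"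
      by (auto simp: xs(2) path_graph_def)
    then have "finite (parcs P)"
      by (rule finite_subset) (simp add: xs(2) path_graph_def)
    then show ?thesis
      using xs by unfold_locales
        (auto simp: path_graph_def symmetric_def nth_eq_iff_index_eq intro!: symI)
  qed
  from assms obtain \<P> where fin: "finite \<P>" and P: "\<forall>P\<in>\<P>. is_path P"
    and H: "H = \<lparr> pverts = (\<Union>P\<in>\<P>. pverts P), parcs = (\<Union>P\<in>\<P>. parcs P) \<rparr>"
    by (auto simp: linear_forest_def)
  have P: "pair_graph P" if "P \<in> \<P>" for P
    using P that path by blast
  show ?thesis
  proof
    show "fst e \<in> pverts H" "snd e \<in> pverts H" if "e \<in> parcs H" for e
      using that P H by (auto dest: pair_wf_digraph.arc_fst_in_verts[rotated]
        pair_wf_digraph.arc_snd_in_verts[rotated] simp: pair_graph_def pair_digraph_def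
        pair_fin_digraph_def intro!: bexI)
    show "finite (pverts H)" "finite (parcs H)"
      using fin P H by (auto simp: pair_graph_def pair_digraph_def
        intro: pair_fin_digraph.pair_finite_verts pair_fin_digraph.pair_finite_arcs)
    show "fst e \<noteq> snd e" if "e \<in> parcs H" for e
      using that P H by (auto simp: pair_graph_def pair_digraph_def
        dest: pair_loopfree_digraph.pair_no_loops)
    show "symmetric (with_proj H)"
      unfolding symmetric_def
    proof (rule symI)
      fix a b assume "(a, b) \<in> arcs_ends (with_proj H)"
      then obtain P where PP: "P \<in> \<P>" "(a, b) \<in> parcs P" using H by auto
      interpret pair_graph P using PP(1) by (rule P)
      show "(b, a) \<in> arcs_ends (with_proj H)"
        using H PP arcs_symmetric by auto
    qed
  qed
qed

lemma pair_graph_Blob: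
  assumes "pair_graph G"
  shows "pair_graph (Blob G)"
proof -
  interpret pair_graph G by fact
  have fin: "finite (pverts (Blob G))"
    by (rule finite_subset[of _ "Pow (pverts G)"]) (auto simp: Blob_def Let_def pair_finite_verts)
  have sub: "parcs (Blob G) \<subseteq> pverts (Blob G) \<times> pverts (Blob G)"
    by (auto simp: Blob_def Let_def)
  have "adjacent_sets G X Y \<Longrightarrow> adjacent_sets G Y X" for X Y
    unfolding adjacent_sets_def by (blast dest: arcs_symmetric)
  then show ?thesis
    using fin sub finite_subset[OF sub] by unfold_locales
      (auto simp: Blob_def Let_def symmetric_def intro!: symI)
qed

end

theory Submission
  imports Defs
begin

text \<open>
  Singletons are blobs, so \<open>G\<close> is an induced subgraph of its blob graph. Conversely, let
  \<open>X\<^sub>0, \<dots>, X\<^bsub>k-1\<^esub>\<close> be the blobs of an induced path, and let \<open>U\<close> be their union, which is connected.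
  Choose \<open>x \<in> X\<^sub>0\<close> and \<open>y \<in> X\<^bsub>k-1\<^esub>\<close>, distinct if \<open>k \<ge> 2\<close>. Since \<open>X\<^sub>i\<close> and \<open>X\<^sub>j\<close> are not
  adjacent for \<open>|i - j| \<ge> 2\<close>, a vertex at distance \<open>t \<ge> 1\<close> from \<open>x\<close> in \<open>G[U]\<close> lies only in blobs of
  index at most \<open>t\<close>. Hence a shortest path from \<open>x\<close> to \<open>y\<close> in \<open>G[U]\<close>, which is induced, has at
  least \<open>k\<close> vertices; keep the first \<open>k\<close>. Blobs of different components of the linear forest are not
  adjacent, so the paths found for the components do not touch.
\<close>

section \<open>Induced subgraphs as vertex maps\<close>

definition induced_embedding ::
    "('b \<Rightarrow> 'a) \<Rightarrow> 'b pair_pre_digraph \<Rightarrow> 'a pair_pre_digraph \<Rightarrow> bool" where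
  "induced_embedding f H G \<longleftrightarrow> inj_on f (pverts H) \<and> f ` pverts H \<subseteq> pverts G \<and>
     (\<forall>u\<in>pverts H. \<forall>v\<in>pverts H. (f u, f v) \<in> parcs G \<longleftrightarrow> (u, v) \<in> parcs H)"

text \<open>An arc is the pair of its ends, so the arc part of an isomorphism is forced by its
  vertex part. Everything after this works with plain functions on vertices.\<close>

lemma contains_induced_iff_embedding:
  assumes "pair_wf_digraph G" "pair_wf_digraph H"
  shows "contains_induced G H \<longleftrightarrow> (\<exists>f. induced_embedding f H G)"
proof
  interpret G: pair_wf_digraph G by fact
  interpret H: pair_wf_digraph H by fact
  {
    assume "contains_induced G H"
    then obtain h where ind: "induced_subgraph (app_iso h (with_proj H)) (with_proj G)"
      and h: "pre_digraph.digraph_isomorphism (with_proj H) h"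
      unfolding contains_induced_def digraph_iso_def by blast
    let ?f = "iso_verts h"
    \<comment> \<open>A subgraph has the same tail and head maps as the ambient graph, here the
      projections of \<open>with_proj G\<close>.\<close>
    have tail: "iso_tail h = fst" and head: "iso_head h = snd"
      using ind by (auto simp: induced_subgraph_def subgraph_def compatible_def)
    have arcs: "iso_arcs h ` parcs H = {e \<in> parcs G. fst e \<in> ?f ` pverts H \<and> snd e \<in> ?f ` pverts H}"
      using ind by (simp add: induced_subgraph_def)
    have arc: "iso_arcs h (u, v) = (?f u, ?f v)" if "(u, v) \<in> parcs H" for u v
      using that h tail head
      by (auto simp: pre_digraph.digraph_isomorphism_def prod_eq_iff)
    have inj: "inj_on ?f (pverts H)"
      using h by (simp add: pre_digraph.digraph_isomorphism_def)
    have sub: "?f ` pverts H \<subseteq> pverts G"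
      using ind by (simp add: induced_subgraph_def subgraph_def)
    have "(?f u, ?f v) \<in> parcs G \<longleftrightarrow> (u, v) \<in> parcs H"
      if uv: "u \<in> pverts H" "v \<in> pverts H" for u v
    proof
      assume "(?f u, ?f v) \<in> parcs G"
      then have "(?f u, ?f v) \<in> iso_arcs h ` parcs H"
        using uv arcs by auto
      then obtain a b where ab: "(a, b) \<in> parcs H" "(?f u, ?f v) = (?f a, ?f b)"
        using arc by auto
      then have "a \<in> pverts H" "b \<in> pverts H"
        by (auto dest: H.in_arcsD1 H.in_arcsD2)
      then have "a = u" "b = v"
        using ab uv inj by (auto dest: inj_onD)
      then show "(u, v) \<in> parcs H"
        using ab by simp
    next
      assume uv_arc: "(u, v) \<in> parcs H"
      then have "iso_arcs h (u, v) \<in> parcs G"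
        using arcs by blast
      then show "(?f u, ?f v) \<in> parcs G"
        using arc[OF uv_arc] by simp
    qed
    then show "\<exists>f. induced_embedding f H G"
      using inj sub unfolding induced_embedding_def by blast
  next
    assume "\<exists>f. induced_embedding f H G"
    then obtain f where inj: "inj_on f (pverts H)" and sub: "f ` pverts H \<subseteq> pverts G"
      and arc: "\<And>u v. u \<in> pverts H \<Longrightarrow> v \<in> pverts H \<Longrightarrow>
        (f u, f v) \<in> parcs G \<longleftrightarrow> (u, v) \<in> parcs H"
      unfolding induced_embedding_def by blast
    define h where "h = \<lparr> iso_verts = f, iso_arcs = map_prod f f, iso_head = snd, iso_tail = fst \<rparr>"
    have verts: "u \<in> pverts H \<and> v \<in> pverts H" if "(u, v) \<in> parcs H" for u v
      using that by (auto dest: H.in_arcsD1 H.in_arcsD2)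
    have "inj_on (map_prod f f) (parcs H)"
      by (rule inj_on_subset[OF map_prod_inj_on[OF inj inj]]) (auto dest: verts)
    then have iso: "pre_digraph.digraph_isomorphism (with_proj H) h"
      using inj by (auto simp: pre_digraph.digraph_isomorphism_def h_def intro: H.wf_digraph_axioms)
    have "map_prod f f ` parcs H
        = {e \<in> parcs G. fst e \<in> f ` pverts H \<and> snd e \<in> f ` pverts H}"
      (is "?L = ?R")
    proof
      show "?L \<subseteq> ?R"
        using arc verts by auto
      show "?R \<subseteq> ?L"
      proof
        fix e assume e: "e \<in> ?R"
        then obtain u v where uv: "u \<in> pverts H" "v \<in> pverts H" "e = map_prod f f (u, v)"
          by (metis (no_types, lifting) imageE mem_Collect_eq map_prod_simp prod.collapse)
        then have "(u, v) \<in> parcs H"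
          using e arc by simp
        then show "e \<in> ?L"
          using uv(3) by blast
      qed
    qed
    then have "app_iso h (with_proj H) = with_proj G \<restriction> (f ` pverts H)"
      by (simp add: app_iso_def h_def induce_subgraph_def)
    then show "contains_induced G H"
      unfolding contains_induced_def digraph_iso_def
      using iso G.induced_induce[of "f ` pverts H"] sub by (metis with_proj_simps(1))
  }
qed

section \<open>Blobs and their adjacency\<close>

lemma pverts_Blob: "X \<in> pverts (Blob G) \<longleftrightarrow> X \<subseteq> pverts G \<and> connected (with_proj G \<restriction> X)"
  by (simp add: Blob_def Let_def)

lemma parcs_Blob:
  "(X, Y) \<in> parcs (Blob G) \<longleftrightarrow>
     X \<in> pverts (Blob G) \<and> Y \<in> pverts (Blob G) \<and> X \<noteq> Y \<and> adjacent_sets G X Y"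
  by (simp add: Blob_def Let_def)

lemma singleton_blob:
  assumes "v \<in> pverts G"
  shows "{v} \<in> pverts (Blob G)"
  using assms by (auto simp: pverts_Blob connected_def strongly_connected_def reachable_def)

lemma blob_nonempty: "X \<in> pverts (Blob G) \<Longrightarrow> X \<noteq> {}"
  by (auto simp: pverts_Blob connected_def strongly_connected_def)

text \<open>\<open>connected\<close> refers to the symmetric closure of the induced subgraph. As
  \<open>G\<close> is symmetric, that closure adds no arcs, so reachability uses only arcs of
  \<open>G\<close> inside \<open>X\<close>.\<close>

lemma blob_connected:
  assumes "pair_graph G" "X \<in> pverts (Blob G)" "u \<in> X" "v \<in> X"
  shows "(u, v) \<in> (parcs G \<inter> X \<times> X)\<^sup>*"
proof -
  interpret pair_graph G by fact
  have "u \<rightarrow>\<^sup>*\<^bsub>mk_symmetric (with_proj G \<restriction> X)\<^esub> v"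
    using assms by (auto simp: pverts_Blob connected_def strongly_connected_def)
  then have "(u, v) \<in> (parcs (mk_symmetric (with_proj G \<restriction> X)))\<^sup>*"
    using reachable_rtranclI by fastforce
  moreover have "parcs (mk_symmetric (with_proj G \<restriction> X)) \<subseteq> parcs G \<inter> X \<times> X"
    by (auto simp: parcs_mk_symmetric arcs_symmetric)
  ultimately show ?thesis
    using rtrancl_mono by blast
qed

text \<open>Distinct singletons are disjoint, so their adjacency reduces to an arc of
  \<open>G\<close>; for equal ones, neither graph has a loop.\<close>

lemma induced_embedding_Blob:
  assumes "pair_graph G"
  shows "induced_embedding (\<lambda>v. {v}) G (Blob G)"
proof -
  interpret pair_graph G by fact
  show ?thesis
    by (auto simp: induced_embedding_def parcs_Blob singleton_blob adjacent_sets_def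
        dest: no_loops')
qed

lemma induced_embedding_comp:
  assumes "induced_embedding f H G" "induced_embedding g G K"
  shows "induced_embedding (g \<circ> f) H K"
  using assms unfolding induced_embedding_def
  by (auto intro!: comp_inj_on intro: inj_on_subset simp: image_subset_iff)

section \<open>Shortest paths through sequences of blobs\<close>

text \<open>In a walk of least length, a repeated vertex or a forward chord would give a shortcut. A
  general relation is allowed because the path must stay inside the union of the blobs.\<close>

lemma shortest_path:
  assumes "(x, y) \<in> R\<^sup>*"
  obtains p :: "nat \<Rightarrow> 'a" and n where "p 0 = x" "p n = y"
    "\<And>i. i < n \<Longrightarrow> (p i, p (Suc i)) \<in> R"
    "\<And>i j. i < j \<Longrightarrow> j \<le> n \<Longrightarrow> p i \<noteq> p j"
    "\<And>i j. i < j \<Longrightarrow> j \<le> n \<Longrightarrow> (p i, p j) \<in> R \<Longrightarrow> j = Suc i"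
proof -
  define n where "n = (LEAST n. (x, y) \<in> R ^^ n)"
  have ex: "\<exists>n. (x, y) \<in> R ^^ n"
    using assms by (simp add: rtrancl_power)
  have n: "(x, y) \<in> R ^^ n"
    unfolding n_def using ex by (rule LeastI_ex)
  have least: "n \<le> m" if "(x, y) \<in> R ^^ m" for m
    unfolding n_def using that by (rule Least_le)
  obtain p where p0: "p 0 = x" and pn: "p n = y"
    and step: "\<And>i. i < n \<Longrightarrow> (p i, p (Suc i)) \<in> R"
    using n by (auto simp: relpow_fun_conv)
  have sub: "(p i, p (i + d)) \<in> R ^^ d" if "i + d \<le> n" for i d
    using that unfolding relpow_fun_conv
    by (intro exI[of _ "\<lambda>l. p (i + l)"]) (simp add: step)
  \<comment> \<open>Replacing the segment from \<open>p i\<close> to \<open>p j\<close> by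
    \<open>m\<close> steps cannot beat the minimum \<open>n\<close>. Taking \<open>m\<close> as 0
    excludes repetitions, as 1 chords.\<close>
  have geod: "j \<le> i + m" if ij: "i \<le> n" "j \<le> n" and m: "(p i, p j) \<in> R ^^ m" for i j m
  proof -
    have "(x, p i) \<in> R ^^ i"
      using sub[of 0 i] ij p0 by simp
    moreover have "(p j, y) \<in> R ^^ (n - j)"
      using sub[of j "n - j"] ij pn by simp
    ultimately have "(x, y) \<in> R ^^ (i + m + (n - j))"
      using m by (auto simp: relpow_add)
    then show ?thesis
      using least ij by fastforce
  qed
  show thesis
  proof (rule that[OF p0 pn step])
    show "p i \<noteq> p j" if "i < j" "j \<le> n" for i j
      using that geod[of i j 0] by auto
    show "j = Suc i" if "i < j" "j \<le> n" "(p i, p j) \<in> R" for i j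
      using that geod[of i j 1] by auto
  qed
qed

text \<open>Induction on the index of the blob reached: walk inside the current blob, then cross to
  the next one by an arc or at a shared vertex.\<close>

lemma path_of_blobs_connected:
  assumes G: "pair_graph G"
    and blob: "\<And>i. i < k \<Longrightarrow> X i \<in> pverts (Blob G)"
    and adj: "\<And>i. Suc i < k \<Longrightarrow> adjacent_sets G (X i) (X (Suc i))"
    and x: "x \<in> X 0" and i: "i < k" and y: "y \<in> X i"
  shows "(x, y) \<in> (parcs G \<inter> (\<Union>i<k. X i) \<times> (\<Union>i<k. X i))\<^sup>*"
proof -
  define R where "R = parcs G \<inter> (\<Union>i<k. X i) \<times> (\<Union>i<k. X i)"
  have within: "(u, v) \<in> R\<^sup>*" if "i < k" "u \<in> X i" "v \<in> X i" for i u v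
  proof -
    have "parcs G \<inter> X i \<times> X i \<subseteq> R"
      using that(1) by (auto simp: R_def)
    then show ?thesis
      using blob_connected[OF G blob[OF that(1)] that(2,3)] rtrancl_mono by blast
  qed
  have "(x, y) \<in> R\<^sup>*"
    using i y
  proof (induction i arbitrary: y)
    case 0
    then show ?case using within x by blast
  next
    case (Suc i)
    then obtain u v where uv: "u \<in> X i" "v \<in> X (Suc i)" "u = v \<or> (u, v) \<in> parcs G"
      using adj unfolding adjacent_sets_def by blast
    then have "u = v \<or> (u, v) \<in> R"
      using Suc.prems(1) unfolding R_def by (auto intro: Suc_lessD)
    moreover have "(x, u) \<in> R\<^sup>*"
      using Suc uv(1) by simp
    moreover have "(v, y) \<in> R\<^sup>*"
      using within Suc.prems uv(2) by blast
    ultimately show ?case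
      by (auto intro: rtrancl_into_rtrancl rtrancl_trans)
  qed
  then show ?thesis by (simp add: R_def)
qed

text \<open>Vertices picked one from each blob need not be adjacent when they should be, so
  \<open>q i\<close> is only required to lie in the union, not in \<open>X i\<close>.\<close>

lemma induced_path_in_path_of_blobs:
  assumes G: "pair_graph G" and "k > 0"
    and blob: "\<And>i. i < k \<Longrightarrow> X i \<in> pverts (Blob G)"
    and inj: "inj_on X {..<k}"
    and adj: "\<And>i j. i < k \<Longrightarrow> j < k \<Longrightarrow> i \<noteq> j \<Longrightarrow>
      adjacent_sets G (X i) (X j) \<longleftrightarrow> j = Suc i \<or> i = Suc j"
  obtains q where "\<And>i. i < k \<Longrightarrow> q i \<in> (\<Union>i<k. X i)" "inj_on q {..<k}"
    "\<And>i j. i < k \<Longrightarrow> j < k \<Longrightarrow> (q i, q j) \<in> parcs G \<longleftrightarrow> j = Suc i \<or> i = Suc j"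
proof -
  interpret pair_graph G by fact
  let ?U = "\<Union>i<k. X i"
  define R where "R = parcs G \<inter> ?U \<times> ?U"
  have ne: "X 0 \<noteq> {}" "X (k - 1) \<noteq> {}"
    using blob[of 0] blob[of "k - 1"] blob_nonempty \<open>k > 0\<close> by auto
  \<comment> \<open>This matters for \<open>k = 2\<close>: the two blobs may overlap, and a common
    vertex as both ends would give a path with one vertex only.\<close>
  have "\<exists>x\<in>X 0. \<exists>y\<in>X (k - 1). k > 1 \<longrightarrow> x \<noteq> y"
  proof (cases "k > 1")
    case True
    then have "X 0 \<noteq> X (k - 1)"
      using inj_onD[OF inj, of 0 "k - 1"] by auto
    then show ?thesis using ne by (metis all_not_in_conv set_eqI)
  qed (use ne in blast)
  then obtain x y where x: "x \<in> X 0" and y: "y \<in> X (k - 1)" and xy: "k > 1 \<Longrightarrow> x \<noteq> y"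
    by blast
  have "(x, y) \<in> R\<^sup>*"
    unfolding R_def using G blob _ x _ y
    by (rule path_of_blobs_connected) (use adj \<open>k > 0\<close> in auto)
  then obtain p n where p0: "p 0 = x" and pn: "p n = y"
    and step: "\<And>i. i < n \<Longrightarrow> (p i, p (Suc i)) \<in> R"
    and dist: "\<And>i j. i < j \<Longrightarrow> j \<le> n \<Longrightarrow> p i \<noteq> p j"
    and chordless: "\<And>i j. i < j \<Longrightarrow> j \<le> n \<Longrightarrow> (p i, p j) \<in> R \<Longrightarrow> j = Suc i"
    by (rule shortest_path) blast
  have pU: "p t \<in> ?U" if "t \<le> n" for t
  proof (cases t)
    case 0
    then show ?thesis using p0 x \<open>k > 0\<close> by auto
  next
    case (Suc s)
    then show ?thesis using step[of s] that by (auto simp: R_def)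
  qed
  \<comment> \<open>Staying put or taking one step raises the blob index by at most one; the case
    \<open>u = v\<close> covers a vertex in two blobs.\<close>
  have near: "j \<le> Suc i" if "u \<in> X i" "v \<in> X j" "u = v \<or> (u, v) \<in> R" "i < k" "j < k" for u v i j
  proof (cases "i = j")
    case False
    have "adjacent_sets G (X i) (X j)"
      using that unfolding adjacent_sets_def R_def by blast
    then show ?thesis using adj that False by auto
  qed simp
  \<comment> \<open>The maximum is there for \<open>t = 0\<close>, since \<open>x\<close> may also
    lie in \<open>X 1\<close>.\<close>
  have level: "j \<le> max 1 t" if "t \<le> n" "p t \<in> X j" "j < k" for t j
    using that
  proof (induction t arbitrary: j)
    case 0
    then show ?case using near[of x 0 x j] x p0 \<open>k > 0\<close> by auto
  next
    case (Suc t)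
    have arc: "(p t, p (Suc t)) \<in> R"
      using step Suc.prems by simp
    show ?case
    \<comment> \<open>For the first step the induction hypothesis would only give the bound 2;
      starting from \<open>x\<close> in \<open>X 0\<close> gives 1.\<close>
    proof (cases "t = 0")
      case True
      then show ?thesis using near[of x 0 "p 1" j] arc x p0 Suc.prems \<open>k > 0\<close> by auto
    next
      case False
      obtain i where i: "i < k" "p t \<in> X i"
        using pU[of t] Suc.prems by auto
      then have "i \<le> max 1 t"
        using Suc by simp
      then show ?thesis
        using near[OF i(2) Suc.prems(2) _ i(1) Suc.prems(3)] arc False by auto
    qed
  qed
  \<comment> \<open>The end \<open>y\<close> has level \<open>k - 1\<close>, and \<open>n\<close> is
    positive as \<open>x\<close> and \<open>y\<close> differ, so the bound on levels reads
    \<open>k - 1 \<le> n\<close>.\<close>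
  have "k \<le> Suc n"
  proof (cases "k > 1")
    case True
    then have "n \<noteq> 0"
      using p0 pn xy by metis
    then show ?thesis using level[of n "k - 1"] pn y True by auto
  qed simp
  then have le: "i \<le> n" if "i < k" for i
    using that by simp
  have arc: "(p i, p j) \<in> parcs G \<longleftrightarrow> j = Suc i" if "i < j" "j < k" for i j
  proof
    assume "(p i, p j) \<in> parcs G"
    then show "j = Suc i"
      using chordless[of i j] pU[of i] pU[of j] that le[of i] le[of j] unfolding R_def by simp
  next
    assume "j = Suc i"
    then show "(p i, p j) \<in> parcs G"
      using step[of i] le[OF that(2)] by (simp add: R_def)
  qed
  show thesis
  proof (rule that)
    show "p i \<in> ?U" if "i < k" for i
      using pU le that by blast
    show "inj_on p {..<k}"
      using dist le by (intro linorder_inj_onI) auto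
    show "(p i, p j) \<in> parcs G \<longleftrightarrow> j = Suc i \<or> i = Suc j" if "i < k" "j < k" for i j
      using arc[of i j] arc[of j i] that arcs_symmetric
      by (cases i j rule: linorder_cases) (auto dest: no_loops')
  qed
qed

section \<open>From paths to linear forests\<close>

text \<open>The list of the path numbers its vertices and so its blobs. Keeping the image inside the
  union of these blobs is what later separates different paths.\<close>

lemma path_in_Blob_imp_path:
  assumes G: "pair_graph G" and P: "is_path P" and Y: "induced_embedding Y P (Blob G)"
  shows "\<exists>g. induced_embedding g P G \<and> g ` pverts P \<subseteq> \<Union> (Y ` pverts P)"
proof -
  obtain xs where xs: "xs \<noteq> []" "distinct xs" "P = path_graph xs"
    using P unfolding is_path_def by blast
  define k where "k = length xs"
  have nth: "i < k \<Longrightarrow> j < k \<Longrightarrow> xs ! i = xs ! j \<longleftrightarrow> i = j" for i j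
    using xs(2) by (simp add: k_def nth_eq_iff_index_eq)
  have verts: "pverts P = (!) xs ` {..<k}"
    using xs(3) by (auto simp: path_graph_def k_def set_conv_nth)
  have arcs: "(xs ! i, xs ! j) \<in> parcs P \<longleftrightarrow> j = Suc i \<or> i = Suc j" if "i < k" "j < k" for i j
    using that xs(2,3) by (auto simp: path_graph_def k_def nth_eq_iff_index_eq)
  define X where "X i = Y (xs ! i)" for i
  have in_P: "xs ! i \<in> pverts P" if "i < k" for i
    using that verts by blast
  have blob: "X i \<in> pverts (Blob G)" if "i < k" for i
    using Y in_P[OF that] unfolding induced_embedding_def X_def by blast
  have injX: "inj_on X {..<k}"
    using Y nth in_P unfolding induced_embedding_def inj_on_def X_def by (metis lessThan_iff)
  have adj: "adjacent_sets G (X i) (X j) \<longleftrightarrow> j = Suc i \<or> i = Suc j"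
    if "i < k" "j < k" "i \<noteq> j" for i j
  proof -
    have "X i \<noteq> X j"
      using inj_onD[OF injX] that by auto
    then have "adjacent_sets G (X i) (X j) \<longleftrightarrow> (X i, X j) \<in> parcs (Blob G)"
      using blob that by (simp add: parcs_Blob)
    also have "\<dots> \<longleftrightarrow> (xs ! i, xs ! j) \<in> parcs P"
      using Y in_P that unfolding induced_embedding_def X_def by blast
    finally show ?thesis using arcs that by simp
  qed
  have "k > 0" using xs(1) by (simp add: k_def)
  then obtain q where qU: "\<And>i. i < k \<Longrightarrow> q i \<in> (\<Union>i<k. X i)" and injq: "inj_on q {..<k}"
    and qarc: "\<And>i j. i < k \<Longrightarrow> j < k \<Longrightarrow> (q i, q j) \<in> parcs G \<longleftrightarrow> j = Suc i \<or> i = Suc j"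
    using induced_path_in_path_of_blobs[OF G _ blob injX adj] by blast
  \<comment> \<open>The position of \<open>v\<close> in \<open>xs\<close> serves as its index in the
    path \<open>q\<close>.\<close>
  define g where "g v = q (the_inv_into {..<k} ((!) xs) v)" for v
  have inj_nth: "inj_on ((!) xs) {..<k}"
    using nth by (auto intro: inj_onI)
  have g: "g (xs ! i) = q i" if "i < k" for i
    using the_inv_into_f_f[OF inj_nth] that by (simp add: g_def)
  have "(\<Union>i<k. X i) \<subseteq> pverts G"
    using blob by (auto simp: pverts_Blob)
  then have "induced_embedding g P G"
    unfolding induced_embedding_def verts using qU
    by (auto simp: g qarc arcs nth inj_on_eq_iff[OF injq] intro!: inj_onI simp del: UN_iff)
  moreover have "g ` pverts P \<subseteq> \<Union> (Y ` pverts P)"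
    using qU g by (auto simp: verts X_def)
  ultimately show ?thesis by blast
qed

text \<open>The embeddings of the single paths are glued; what remains to check is vertices from two
  different paths.\<close>

lemma linear_forest_in_Blob_imp:
  assumes G: "pair_graph G" and H: "linear_forest H" and Y: "induced_embedding Y H (Blob G)"
  shows "\<exists>f. induced_embedding f H G"
proof -
  obtain \<P> where paths: "\<And>P. P \<in> \<P> \<Longrightarrow> is_path P"
    and disj: "pairwise (\<lambda>P Q. disjnt (pverts P) (pverts Q)) \<P>"
    and H_eq: "H = \<lparr> pverts = (\<Union>P\<in>\<P>. pverts P), parcs = (\<Union>P\<in>\<P>. parcs P) \<rparr>"
    using H unfolding linear_forest_def by blast
  have uniq: "P = Q" if "P \<in> \<P>" "Q \<in> \<P>" "v \<in> pverts P" "v \<in> pverts Q" for P Q v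
    using disj that unfolding pairwise_def disjnt_def by blast
  have arc_verts: "u \<in> pverts P \<and> v \<in> pverts P" if "P \<in> \<P>" "(u, v) \<in> parcs P" for P u v
    using paths[OF that(1)] that(2) by (auto simp: is_path_def path_graph_def)
  have arc_iff: "(u, v) \<in> parcs H \<longleftrightarrow> P = Q \<and> (u, v) \<in> parcs P"
    if "P \<in> \<P>" "Q \<in> \<P>" "u \<in> pverts P" "v \<in> pverts Q" for P Q u v
    using that uniq arc_verts unfolding H_eq by simp metis
  have sub: "pverts P \<subseteq> pverts H" if "P \<in> \<P>" for P
    using that H_eq by auto
  have "induced_embedding Y P (Blob G)" if P: "P \<in> \<P>" for P
    using Y sub[OF P] arc_iff[OF P P] unfolding induced_embedding_def
    by (auto intro: inj_on_subset simp: subset_iff)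
  then have "\<forall>P\<in>\<P>. \<exists>g. induced_embedding g P G \<and> g ` pverts P \<subseteq> \<Union> (Y ` pverts P)"
    using path_in_Blob_imp_path[OF G paths] by blast
  then obtain g where g: "\<And>P. P \<in> \<P> \<Longrightarrow> induced_embedding (g P) P G"
    and gY: "\<And>P. P \<in> \<P> \<Longrightarrow> g P ` pverts P \<subseteq> \<Union> (Y ` pverts P)"
    by metis
  \<comment> \<open>The description is well defined on \<open>pverts H\<close> because the paths are
    disjoint.\<close>
  define f where "f v = g (THE P. P \<in> \<P> \<and> v \<in> pverts P) v" for v
  have f: "f v = g P v" if "P \<in> \<P>" "v \<in> pverts P" for P v
    using that uniq by (auto simp: f_def intro!: arg_cong2[of _ _ _ _ g] the_equality)
  \<comment> \<open>The images lie in blobs \<open>Y a\<close> and \<open>Y b\<close> with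
    \<open>a\<close>, \<open>b\<close> on different paths. Since intersecting blobs count as
    adjacent, non-adjacency excludes both a common vertex and an arc.\<close>
  have apart: "g P u \<noteq> g Q v \<and> (g P u, g Q v) \<notin> parcs G"
    if PQ: "P \<in> \<P>" "Q \<in> \<P>" "P \<noteq> Q" and uv: "u \<in> pverts P" "v \<in> pverts Q" for P Q u v
  proof -
    obtain a where a: "a \<in> pverts P" "g P u \<in> Y a" using gY PQ uv by blast
    obtain b where b: "b \<in> pverts Q" "g Q v \<in> Y b" using gY PQ uv by blast
    have ab: "a \<in> pverts H" "b \<in> pverts H" "a \<noteq> b" "(a, b) \<notin> parcs H"
      using a b PQ sub uniq arc_iff by blast+
    then have "(Y a, Y b) \<notin> parcs (Blob G)" "Y a \<noteq> Y b"
      "Y a \<in> pverts (Blob G)" "Y b \<in> pverts (Blob G)"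
      using Y unfolding induced_embedding_def by (auto dest: inj_onD)
    then have "\<not> adjacent_sets G (Y a) (Y b)"
      by (simp add: parcs_Blob)
    then show ?thesis
      using a(2) b(2) unfolding adjacent_sets_def by (metis IntI empty_iff)
  qed
  have component: "\<exists>P\<in>\<P>. v \<in> pverts P" if "v \<in> pverts H" for v
    using that H_eq by auto
  have "induced_embedding f H G"
    unfolding induced_embedding_def
  proof (intro conjI ballI)
    show "inj_on f (pverts H)"
    proof (rule inj_onI)
      fix u v assume uv: "u \<in> pverts H" "v \<in> pverts H" "f u = f v"
      obtain P Q where PQ: "P \<in> \<P>" "u \<in> pverts P" "Q \<in> \<P>" "v \<in> pverts Q"
        using component uv by blast
      then have "g P u = g Q v"
        using f uv(3) by simp
      moreover from this have "P = Q"
        using apart PQ by blast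
      ultimately show "u = v"
        using g[of P] PQ unfolding induced_embedding_def by (auto dest: inj_onD)
    qed
    show "f ` pverts H \<subseteq> pverts G"
      using component f g unfolding induced_embedding_def by (fastforce simp: image_subset_iff)
    fix u v assume uv: "u \<in> pverts H" "v \<in> pverts H"
    obtain P Q where PQ: "P \<in> \<P>" "u \<in> pverts P" "Q \<in> \<P>" "v \<in> pverts Q"
      using component uv by blast
    show "(f u, f v) \<in> parcs G \<longleftrightarrow> (u, v) \<in> parcs H"
    proof (cases "P = Q")
      case True
      then show ?thesis
        using PQ f arc_iff[of P P u v] g[of P] unfolding induced_embedding_def by simp
    next
      case False
      then show ?thesis
        using PQ f arc_iff[of P Q u v] apart[of P Q u v] by simp
    qed
  qed
  then show ?thesis by blast
qed

theorem theorem3: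
  fixes H :: "'b pair_pre_digraph" and G :: "'a pair_pre_digraph"
  assumes "linear_forest H" and "pair_graph G"
  shows "contains_induced G H \<longleftrightarrow> contains_induced (Blob G) H"
proof -
  interpret G: pair_graph G by fact
  interpret H: pair_graph H using assms(1) by (rule pair_graph_linear_forest)
  interpret B: pair_graph "Blob G" using assms(2) by (rule pair_graph_Blob)
  show ?thesis
    unfolding contains_induced_iff_embedding[OF G.pair_wf_digraph_axioms H.pair_wf_digraph_axioms]
      contains_induced_iff_embedding[OF B.pair_wf_digraph_axioms H.pair_wf_digraph_axioms]
    using induced_embedding_comp[OF _ induced_embedding_Blob[OF assms(2)]]
      linear_forest_in_Blob_imp[OF assms(2,1)] by blast
qed

end
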